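(* Let $\mathcal{O}$ be a smooth Riemannian manifold, let $\mathcal{B}\subseteq\mathcal{O}$ be a non-empty open subset, and let $E,F:\mathcal{B}\to\mathcal{O}$ and $G:\mathcal{O}\times\mathcal{O}\to T\mathcal{O}$ be maps with $G(E(r),F(s))\in T_{F(s)}\mathcal{O}$ for all $r,s\in\mathcal{B}$, such that $\mathcal{B}$ is geodesic $(E,F)$-invex (with respect to $G$). Let $\mathcal{H}:\mathcal{B}\to\mathbb{R}$ be a differentiable and $(E,F)$-preinvex function. Then $\mathcal{H}$ is an $(E,F)$-invex function on $\mathcal{B}$.
   Context: Let $\mathcal{O}$ be a smooth Riemannian manifold, $\mathcal{B}\subseteq\mathcal{O}$ non-empty, $E,F:\mathcal{B}\to\mathcal{O}$, and $G:\mathcal{O}\times\mathcal{O}\to T\mathcal{O}$ with $G(E(r),F(s))\in T_{F(s)}\mathcal{O}$. The phrase "for each $E(r),F(s)\in\mathcal{B}$" means: for all $r,s\in\mathcal{B}$ with $E(r)\in\mathcal{B}$ and $F(s)\in\mathcal{B}$. Geodesic $(E,F)$-invex set: $\mathcal{B}$ is geodesic $(E,F)$-invex if for each $E(r),F(s)\in\mathcal{B}$ there exists exactly one geodesic $\beta_{E(r),F(s)}:[0,1]\to\mathcal{O}$ such that $\beta_{E(r),F(s)}(0)=F(s)$, $\beta'_{E(r),F(s)}(0)=G(E(r),F(s))$, and $\beta_{E(r),F(s)}(t)\in\mathcal{B}$ for all $t\in[0,1]$. $(E,F)$-preinvex function: if $\mathcal{B}$ is geodesic $(E,F)$-invex,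 $\mathcal{H}:\mathcal{B}\to\mathbb{R}$ is $(E,F)$-preinvex if for each $E(r),F(s)\in\mathcal{B}$ and all $t\in[0,1]$, $\mathcal{H}(\beta_{E(r),F(s)}(t))\le t\,\mathcal{H}(E(r))+(1-t)\,\mathcal{H}(F(s))$, where $\beta_{E(r),F(s)}$ is the unique geodesic above. $(E,F)$-invex function: if $\mathcal{B}$ is open and geodesic $(E,F)$-invex, a differentiable function $\mathcal{H}:\mathcal{B}\to\mathbb{R}$ is $(E,F)$-invex on $\mathcal{B}$ if $\mathcal{H}(E(r))-\mathcal{H}(F(s))\ge d\mathcal{H}_{F(s)}\big(G(E(r),F(s))\big)$ for each $E(r),F(s)\in\mathcal{B}$. *)

theory Defs
  imports "HOL-Analysis.Analysis"
begin

section \<open>Smooth maps between normed spaces\<close>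

text \<open>
  \<open>C\<^sup>k\<close> maps through iterated directional derivatives, which is the usual notion on a
  finite-dimensional domain. The set \<open>S\<close> is meant to be open, or relatively open in a
  nondegenerate interval of the real line; then derivatives within \<open>S\<close> are unique (and one-sided
  at the end points of the interval).
\<close>

fun Ck_on :: "nat \<Rightarrow> 'a::real_normed_vector set \<Rightarrow> ('a \<Rightarrow> 'b::real_normed_vector) \<Rightarrow> bool" where
  "Ck_on 0 S f \<longleftrightarrow> continuous_on S f"
| "Ck_on (Suc k) S f \<longleftrightarrow>
     f differentiable_on S \<and> (\<forall>v. Ck_on k S (\<lambda>x. frechet_derivative f (at x within S) v))"

definition smooth_on :: "'a::real_normed_vector set \<Rightarrow> ('a \<Rightarrow> 'b::real_normed_vector) \<Rightarrow> bool" where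
  "smooth_on S f \<longleftrightarrow> (\<forall>k. Ck_on k S f)"

section \<open>Smooth manifolds\<close>

text \<open>
  The manifold is a whole Hausdorff second countable type \<open>'m\<close>. A chart is a pair \<open>(U, \<phi>)\<close> of its
  domain and its coordinate map; the values of \<open>\<phi>\<close> outside \<open>U\<close> are irrelevant. The model space
  \<open>'e\<close> is any finite-dimensional normed space and not of class \<open>euclidean_space\<close>, because the
  latter excludes dimension 0.
\<close>

type_synonym ('m, 'e) chart = "'m set \<times> ('m \<Rightarrow> 'e)"

abbreviation chart_inv :: "('m, 'e) chart \<Rightarrow> 'e \<Rightarrow> 'm" where
  "chart_inv c \<equiv> inv_into (fst c) (snd c)"

definition transition :: "('m, 'e) chart \<Rightarrow> ('m, 'e) chart \<Rightarrow> 'e \<Rightarrow> 'e" where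
  "transition c d = snd d \<circ> chart_inv c"

definition smooth_atlas ::
    "('m::{t2_space, second_countable_topology}, 'e::real_normed_vector) chart set \<Rightarrow> bool" where
  "smooth_atlas A \<longleftrightarrow>
     (\<exists>K :: 'e set. finite K \<and> span K = UNIV) \<and>
     (\<Union>c\<in>A. fst c) = UNIV \<and>
     (\<forall>c\<in>A. open (fst c) \<and> open (snd c ` fst c) \<and>
        homeomorphism (fst c) (snd c ` fst c) (snd c) (chart_inv c)) \<and>
     (\<forall>c\<in>A. \<forall>d\<in>A. smooth_on (snd c ` (fst c \<inter> fst d)) (transition c d))"

section \<open>Tangent vectors\<close>

text \<open>
  A tangent vector at \<open>p\<close> is the family of its components in all charts around \<open>p\<close>; components in
  different charts are related by the derivative of the transition map. The family is 0 at all
  other charts, so that a tangent space is a linear subspace of the functions on charts.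
\<close>

type_synonym ('m, 'e) tangent_vector = "('m, 'e) chart \<Rightarrow> 'e"

definition tangent_space ::
    "('m, 'e::real_normed_vector) chart set \<Rightarrow> 'm \<Rightarrow> ('m, 'e) tangent_vector set" where
  "tangent_space A p =
     {v. (\<forall>c. \<not> (c \<in> A \<and> p \<in> fst c) \<longrightarrow> v c = 0) \<and>
         (\<forall>c\<in>A. \<forall>d\<in>A. p \<in> fst c \<longrightarrow> p \<in> fst d \<longrightarrow>
            v d = frechet_derivative (transition c d) (at (snd c p)) (v c))}"

definition tangent_bundle ::
    "('m, 'e::real_normed_vector) chart set \<Rightarrow> ('m \<times> ('m, 'e) tangent_vector) set" where
  "tangent_bundle A = (SIGMA p:UNIV. tangent_space A p)"

text \<open>The tangent vector at \<open>p\<close> with component \<open>a\<close> in the chart \<open>c\<close>.\<close>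

definition coord_vector ::
    "('m, 'e::real_normed_vector) chart set \<Rightarrow> ('m, 'e) chart \<Rightarrow> 'm \<Rightarrow> 'e \<Rightarrow> ('m, 'e) tangent_vector"
  where
  "coord_vector A c p a =
     (\<lambda>d. if d \<in> A \<and> p \<in> fst d then frechet_derivative (transition c d) (at (snd c p)) a else 0)"

section \<open>Riemannian metrics\<close>

text \<open>The metric in the chart \<open>c\<close> at the point with coordinates \<open>x\<close>.\<close>

definition metric_coord ::
    "('m, 'e::real_normed_vector) chart set \<Rightarrow>
     ('m \<Rightarrow> ('m, 'e) tangent_vector \<Rightarrow> ('m, 'e) tangent_vector \<Rightarrow> real) \<Rightarrow>
     ('m, 'e) chart \<Rightarrow> 'e \<Rightarrow> 'e \<Rightarrow> 'e \<Rightarrow> real" where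
  "metric_coord A g c x a b =
     (let p = chart_inv c x in g p (coord_vector A c p a) (coord_vector A c p b))"

definition riemannian_metric ::
    "('m, 'e::real_normed_vector) chart set \<Rightarrow>
     ('m \<Rightarrow> ('m, 'e) tangent_vector \<Rightarrow> ('m, 'e) tangent_vector \<Rightarrow> real) \<Rightarrow> bool" where
  "riemannian_metric A g \<longleftrightarrow>
     (\<forall>p. \<forall>u\<in>tangent_space A p. \<forall>v\<in>tangent_space A p. g p u v = g p v u) \<and>
     (\<forall>p. \<forall>u\<in>tangent_space A p. \<forall>v\<in>tangent_space A p. \<forall>w\<in>tangent_space A p.
        g p (\<lambda>c. u c + v c) w = g p u w + g p v w) \<and>
     (\<forall>p. \<forall>u\<in>tangent_space A p. \<forall>w\<in>tangent_space A p. \<forall>r.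
        g p (\<lambda>c. r *\<^sub>R u c) w = r * g p u w) \<and>
     (\<forall>p. \<forall>u\<in>tangent_space A p. u \<noteq> (\<lambda>c. 0) \<longrightarrow> g p u u > 0) \<and>
     (\<forall>c\<in>A. \<forall>a b. smooth_on (snd c ` fst c) (\<lambda>x. metric_coord A g c x a b))"

definition riemannian_manifold ::
    "('m::{t2_space, second_countable_topology}, 'e::real_normed_vector) chart set \<Rightarrow>
     ('m \<Rightarrow> ('m, 'e) tangent_vector \<Rightarrow> ('m, 'e) tangent_vector \<Rightarrow> real) \<Rightarrow> bool" where
  "riemannian_manifold A g \<longleftrightarrow> smooth_atlas A \<and> riemannian_metric A g"

section \<open>Geodesics\<close>

text \<open>
  The Levi-Civita connection in the chart \<open>c\<close>: \<open>christoffel A g c x a b\<close> is the vector with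
  \<open>k\<close>-th component \<open>\<Gamma>\<^sup>k\<^sub>i\<^sub>j a\<^sup>i b\<^sup>j\<close>. It is determined by lowering the index, where
  \<open>\<Gamma>\<^sub>i\<^sub>j\<^sub>l = (\<partial>\<^sub>i g\<^sub>j\<^sub>l + \<partial>\<^sub>j g\<^sub>i\<^sub>l - \<partial>\<^sub>l g\<^sub>i\<^sub>j) / 2\<close>.
\<close>

definition christoffel ::
    "('m, 'e::real_normed_vector) chart set \<Rightarrow>
     ('m \<Rightarrow> ('m, 'e) tangent_vector \<Rightarrow> ('m, 'e) tangent_vector \<Rightarrow> real) \<Rightarrow>
     ('m, 'e) chart \<Rightarrow> 'e \<Rightarrow> 'e \<Rightarrow> 'e \<Rightarrow> 'e" where
  "christoffel A g c x a b =
     (THE w. \<forall>z. metric_coord A g c x w z =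
        (frechet_derivative (\<lambda>y. metric_coord A g c y b z) (at x) a
         + frechet_derivative (\<lambda>y. metric_coord A g c y a z) (at x) b
         - frechet_derivative (\<lambda>y. metric_coord A g c y a b) (at x) z) / 2)"

definition smooth_path ::
    "('m::topological_space, 'e::real_normed_vector) chart set \<Rightarrow> (real \<Rightarrow> 'm) \<Rightarrow> bool" where
  "smooth_path A \<beta> \<longleftrightarrow>
     continuous_on {0..1} \<beta> \<and>
     (\<forall>c\<in>A. smooth_on {t\<in>{0..1}. \<beta> t \<in> fst c} (\<lambda>t. snd c (\<beta> t)))"

text \<open>
  Derivatives of paths are taken within \<open>[0,1]\<close>. They only depend on the path near \<open>t\<close>, so it does
  not matter that \<open>\<beta>\<close> may leave the domain of the chart elsewhere.
\<close>

definition coord_velocity :: "('m, 'e::real_normed_vector) chart \<Rightarrow> (real \<Rightarrow> 'm) \<Rightarrow> real \<Rightarrow> 'e" where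
  "coord_velocity c \<beta> t = vector_derivative (\<lambda>s. snd c (\<beta> s)) (at t within {0..1})"

definition velocity ::
    "('m, 'e::real_normed_vector) chart set \<Rightarrow> (real \<Rightarrow> 'm) \<Rightarrow> real \<Rightarrow> 'm \<times> ('m, 'e) tangent_vector"
  where
  "velocity A \<beta> t = (\<beta> t, \<lambda>c. if c \<in> A \<and> \<beta> t \<in> fst c then coord_velocity c \<beta> t else 0)"

text \<open>The component of the covariant derivative of \<open>\<beta>'\<close> along \<open>\<beta>\<close> in the chart \<open>c\<close>.\<close>

definition coord_acceleration ::
    "('m, 'e::real_normed_vector) chart set \<Rightarrow>
     ('m \<Rightarrow> ('m, 'e) tangent_vector \<Rightarrow> ('m, 'e) tangent_vector \<Rightarrow> real) \<Rightarrow>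
     ('m, 'e) chart \<Rightarrow> (real \<Rightarrow> 'm) \<Rightarrow> real \<Rightarrow> 'e" where
  "coord_acceleration A g c \<beta> t =
     vector_derivative (coord_velocity c \<beta>) (at t within {0..1})
     + christoffel A g c (snd c (\<beta> t)) (coord_velocity c \<beta> t) (coord_velocity c \<beta> t)"

definition geodesic ::
    "('m::topological_space, 'e::real_normed_vector) chart set \<Rightarrow>
     ('m \<Rightarrow> ('m, 'e) tangent_vector \<Rightarrow> ('m, 'e) tangent_vector \<Rightarrow> real) \<Rightarrow>
     (real \<Rightarrow> 'm) \<Rightarrow> bool" where
  "geodesic A g \<beta> \<longleftrightarrow>
     smooth_path A \<beta> \<and>
     (\<forall>c\<in>A. \<forall>t\<in>{0..1}. \<beta> t \<in> fst c \<longrightarrow> coord_acceleration A g c \<beta> t = 0)"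

section \<open>Differentiable functions\<close>

definition differentiable_fun_on ::
    "('m::topological_space, 'e::real_normed_vector) chart set \<Rightarrow> 'm set \<Rightarrow> ('m \<Rightarrow> real) \<Rightarrow> bool" where
  "differentiable_fun_on A B H \<longleftrightarrow>
     open B \<and>
     (\<forall>p\<in>B. \<forall>c\<in>A. p \<in> fst c \<longrightarrow> (\<lambda>x. H (chart_inv c x)) differentiable at (snd c p))"

definition differential ::
    "('m, 'e::real_normed_vector) chart set \<Rightarrow> ('m \<Rightarrow> real) \<Rightarrow> 'm \<Rightarrow> ('m, 'e) tangent_vector \<Rightarrow> real"
  where
  "differential A H p v =
     (let c = (SOME c. c \<in> A \<and> p \<in> fst c)
      in frechet_derivative (\<lambda>x. H (chart_inv c x)) (at (snd c p)) (v c))"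

lemma transition_has_derivative:
  assumes A: "smooth_atlas A" and c: "c \<in> A" "p \<in> fst c" and d: "d \<in> A" "p \<in> fst d"
  shows "(transition c d has_derivative frechet_derivative (transition c d) (at (snd c p)))
           (at (snd c p))"
proof -
  let ?S = "snd c ` (fst c \<inter> fst d)"
  from A c have hom: "homeomorphism (fst c) (snd c ` fst c) (snd c) (chart_inv c)"
    and op: "open (fst c)" "open (snd c ` fst c)"
    by (auto simp: smooth_atlas_def)
  from A d have "open (fst d)" by (auto simp: smooth_atlas_def)
  then have "openin (top_of_set (fst c)) (fst c \<inter> fst d)" by (auto simp: openin_open)
  then have "openin (top_of_set (snd c ` fst c)) ?S"
    by (rule homeomorphism_imp_open_map[OF hom])
  with op have opS: "open ?S" using openin_open_trans by blast
  from A c d have "smooth_on ?S (transition c d)" by (auto simp: smooth_atlas_def)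
  then have "Ck_on (Suc 0) ?S (transition c d)" unfolding smooth_on_def by blast
  then have "transition c d differentiable_on ?S" by simp
  moreover have "snd c p \<in> ?S" using c d by auto
  ultimately have "transition c d differentiable at (snd c p)"
    using opS by (simp only: differentiable_on_eq_differentiable_at)
  then show ?thesis using frechet_derivative_works by blast
qed

text \<open>The differential does not depend on the choice of the chart.\<close>

lemma differential_chart:
  assumes A: "smooth_atlas A" and H: "differentiable_fun_on A B H" and p: "p \<in> B"
    and c: "c \<in> A" "p \<in> fst c" and v: "v \<in> tangent_space A p"
  shows "differential A H p v = frechet_derivative (\<lambda>x. H (chart_inv c x)) (at (snd c p)) (v c)"
proof -
  define d where "d = (SOME d. d \<in> A \<and> p \<in> fst d)"
  have d: "d \<in> A" "p \<in> fst d"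
    using someI[of "\<lambda>d. d \<in> A \<and> p \<in> fst d" c] c by (auto simp: d_def)
  have hom: "homeomorphism (fst c) (snd c ` fst c) (snd c) (chart_inv c)"
    and homd: "homeomorphism (fst d) (snd d ` fst d) (snd d) (chart_inv d)"
    and op: "open (fst c)" "open (snd c ` fst c)" "open (fst d)" "open (snd d ` fst d)"
    using A c d by (auto simp: smooth_atlas_def)
  have tr: "(transition c d has_derivative frechet_derivative (transition c d) (at (snd c p)))
      (at (snd c p))"
    by (rule transition_has_derivative[OF A c d])
  have trp: "transition c d (snd c p) = snd d p"
    using hom c by (auto simp: transition_def homeomorphism_def)
  have "(\<lambda>x. H (chart_inv d x)) differentiable at (snd d p)"
    using H p d by (auto simp: differentiable_fun_on_def)
  then have Hd: "((\<lambda>x. H (chart_inv d x)) has_derivative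
      frechet_derivative (\<lambda>x. H (chart_inv d x)) (at (snd d p))) (at (transition c d (snd c p)))"
    unfolding trp by (simp add: frechet_derivative_works)
  let ?S = "snd c ` (fst c \<inter> fst d)"
  have "openin (top_of_set (fst c)) (fst c \<inter> fst d)" using op by (auto simp: openin_open)
  then have "openin (top_of_set (snd c ` fst c)) ?S"
    by (rule homeomorphism_imp_open_map[OF hom])
  with op have opS: "open ?S" using openin_open_trans by blast
  have "((\<lambda>x. H (chart_inv c x)) has_derivative
      (\<lambda>y. frechet_derivative (\<lambda>x. H (chart_inv d x)) (at (snd d p))
            (frechet_derivative (transition c d) (at (snd c p)) y))) (at (snd c p))"
  proof (rule has_derivative_transform_within_open[OF has_derivative_compose[OF tr Hd] opS])
    show "snd c p \<in> ?S" using c d by auto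
  next
    fix x assume "x \<in> ?S"
    then obtain q where q: "q \<in> fst c" "q \<in> fst d" "x = snd c q" by auto
    then show "H (chart_inv d (transition c d x)) = H (chart_inv c x)"
      using hom homd by (auto simp: transition_def homeomorphism_def)
  qed
  then have "frechet_derivative (\<lambda>x. H (chart_inv c x)) (at (snd c p)) =
      (\<lambda>y. frechet_derivative (\<lambda>x. H (chart_inv d x)) (at (snd d p))
            (frechet_derivative (transition c d) (at (snd c p)) y))"
    by (rule frechet_derivative_at[symmetric])
  moreover have "v d = frechet_derivative (transition c d) (at (snd c p)) (v c)"
    using v c d unfolding tangent_space_def by blast
  ultimately show ?thesis
    unfolding differential_def Let_def d_def[symmetric] by simp
qed

section \<open>Geodesic invexity\<close>

text \<open>
  The maps \<open>E\<close>, \<open>F\<close> and \<open>H\<close> are defined on \<open>B\<close>; their values elsewhere play no role. Paths with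
  domain \<open>[0,1]\<close> are extensional functions, so that unique existence and the choice of the
  unique geodesic make sense.
\<close>

definition is_invex_geodesic ::
    "('m::topological_space, 'e::real_normed_vector) chart set \<Rightarrow>
     ('m \<Rightarrow> ('m, 'e) tangent_vector \<Rightarrow> ('m, 'e) tangent_vector \<Rightarrow> real) \<Rightarrow>
     ('m \<times> 'm \<Rightarrow> 'm \<times> ('m, 'e) tangent_vector) \<Rightarrow> 'm set \<Rightarrow> 'm \<Rightarrow> 'm \<Rightarrow> (real \<Rightarrow> 'm) \<Rightarrow> bool" where
  "is_invex_geodesic A g G B p q \<beta> \<longleftrightarrow>
     \<beta> \<in> {0..1} \<rightarrow>\<^sub>E B \<and> geodesic A g \<beta> \<and> \<beta> 0 = q \<and> velocity A \<beta> 0 = G (p, q)"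

definition invex_geodesic ::
    "('m::topological_space, 'e::real_normed_vector) chart set \<Rightarrow>
     ('m \<Rightarrow> ('m, 'e) tangent_vector \<Rightarrow> ('m, 'e) tangent_vector \<Rightarrow> real) \<Rightarrow>
     ('m \<times> 'm \<Rightarrow> 'm \<times> ('m, 'e) tangent_vector) \<Rightarrow> 'm set \<Rightarrow> 'm \<Rightarrow> 'm \<Rightarrow> real \<Rightarrow> 'm" where
  "invex_geodesic A g G B p q = (THE \<beta>. is_invex_geodesic A g G B p q \<beta>)"

definition geodesic_EF_invex_set ::
    "('m::topological_space, 'e::real_normed_vector) chart set \<Rightarrow>
     ('m \<Rightarrow> ('m, 'e) tangent_vector \<Rightarrow> ('m, 'e) tangent_vector \<Rightarrow> real) \<Rightarrow>
     ('m \<times> 'm \<Rightarrow> 'm \<times> ('m, 'e) tangent_vector) \<Rightarrow> ('m \<Rightarrow> 'm) \<Rightarrow> ('m \<Rightarrow> 'm) \<Rightarrow> 'm set \<Rightarrow> bool" where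
  "geodesic_EF_invex_set A g G E F B \<longleftrightarrow>
     (\<forall>r\<in>B. \<forall>s\<in>B. E r \<in> B \<longrightarrow> F s \<in> B \<longrightarrow> (\<exists>!\<beta>. is_invex_geodesic A g G B (E r) (F s) \<beta>))"

definition EF_preinvex ::
    "('m::topological_space, 'e::real_normed_vector) chart set \<Rightarrow>
     ('m \<Rightarrow> ('m, 'e) tangent_vector \<Rightarrow> ('m, 'e) tangent_vector \<Rightarrow> real) \<Rightarrow>
     ('m \<times> 'm \<Rightarrow> 'm \<times> ('m, 'e) tangent_vector) \<Rightarrow> ('m \<Rightarrow> 'm) \<Rightarrow> ('m \<Rightarrow> 'm) \<Rightarrow> 'm set \<Rightarrow>
     ('m \<Rightarrow> real) \<Rightarrow> bool" where
  "EF_preinvex A g G E F B H \<longleftrightarrow>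
     geodesic_EF_invex_set A g G E F B \<and>
     (\<forall>r\<in>B. \<forall>s\<in>B. E r \<in> B \<longrightarrow> F s \<in> B \<longrightarrow>
        (\<forall>t\<in>{0..1}. H (invex_geodesic A g G B (E r) (F s) t) \<le> t * H (E r) + (1 - t) * H (F s)))"

definition EF_invex ::
    "('m::topological_space, 'e::real_normed_vector) chart set \<Rightarrow>
     ('m \<Rightarrow> ('m, 'e) tangent_vector \<Rightarrow> ('m, 'e) tangent_vector \<Rightarrow> real) \<Rightarrow>
     ('m \<times> 'm \<Rightarrow> 'm \<times> ('m, 'e) tangent_vector) \<Rightarrow> ('m \<Rightarrow> 'm) \<Rightarrow> ('m \<Rightarrow> 'm) \<Rightarrow> 'm set \<Rightarrow>
     ('m \<Rightarrow> real) \<Rightarrow> bool" where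
  "EF_invex A g G E F B H \<longleftrightarrow>
     open B \<and> geodesic_EF_invex_set A g G E F B \<and> differentiable_fun_on A B H \<and>
     (\<forall>r\<in>B. \<forall>s\<in>B. E r \<in> B \<longrightarrow> F s \<in> B \<longrightarrow>
        H (E r) - H (F s) \<ge> differential A H (F s) (snd (G (E r, F s))))"

end

theory Submission
  imports Defs
begin

text \<open>
  Along the geodesic \<open>\<beta>\<close> from \<open>F s\<close> with initial velocity \<open>G (E r, F s)\<close>, preinvexity bounds the
  difference quotient \<open>(H (\<beta> t) - H (\<beta> 0)) / t\<close> by \<open>H (E r) - H (F s)\<close> for \<open>0 < t \<le> 1\<close>; by the chain
  rule the quotient tends to the differential of \<open>H\<close> at \<open>F s\<close> applied to that velocity.
\<close>

text \<open>\<open>smooth_path\<close> gives differentiability only within the set of times at which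
  the path lies in the chart. By continuity this set is relatively open in \<open>{0..1}\<close>, so
  near \<open>t\<close> the two domains, and hence the derivatives, agree.\<close>

lemma smooth_path_coord_velocity:
  assumes A: "smooth_atlas A" and \<beta>: "smooth_path A \<beta>"
    and c: "c \<in> A" "\<beta> t \<in> fst c" and t: "t \<in> {0..1}"
  shows "((\<lambda>s. snd c (\<beta> s)) has_vector_derivative coord_velocity c \<beta> t) (at t within {0..1})"
    and "eventually (\<lambda>s. \<beta> s \<in> fst c) (at t within {0..1})"
proof -
  define S where "S = {s\<in>{0..1}. \<beta> s \<in> fst c}"
  have "continuous_on {0..1} \<beta>" and "smooth_on S (\<lambda>s. snd c (\<beta> s))"
    using \<beta> c(1) unfolding smooth_path_def S_def by auto
  moreover have "open (fst c)"
    using A c(1) by (auto simp: smooth_atlas_def)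
  ultimately obtain T where T: "open T" "T \<inter> {0..1} = \<beta> -` fst c \<inter> {0..1}"
    unfolding continuous_on_open_invariant by blast
  have tT: "t \<in> T" using T(2) t c by blast
  have T_iff: "\<beta> s \<in> fst c \<longleftrightarrow> s \<in> T" if "s \<in> {0..1}" for s
    using T(2) that by blast
  \<comment> \<open>Inside the open neighbourhood \<open>T\<close> of \<open>t\<close>, the sets
    \<open>S\<close> and \<open>{0..1}\<close> have the same points.\<close>
  have within: "at t within S = at t within {0..1}"
    by (rule at_within_nhd[OF tT T(1)]) (auto simp: S_def T_iff)
  have "Ck_on (Suc 0) S (\<lambda>s. snd c (\<beta> s))"
    using \<open>smooth_on S _\<close> unfolding smooth_on_def by blast
  then have "(\<lambda>s. snd c (\<beta> s)) differentiable (at t within S)"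
    using c t by (auto simp: differentiable_on_def S_def)
  then show "((\<lambda>s. snd c (\<beta> s)) has_vector_derivative coord_velocity c \<beta> t) (at t within {0..1})"
    unfolding within coord_velocity_def by (simp add: vector_derivative_works)
  show "eventually (\<lambda>s. \<beta> s \<in> fst c) (at t within {0..1})"
    unfolding eventually_at_topological using T(1) tT T_iff by blast
qed

text \<open>Near \<open>t\<close>, \<open>H\<close> along the path factors through a chart as
  \<open>H (chart_inv c x)\<close> after \<open>x = snd c (\<beta> s)\<close>, so the chain rule
  between normed spaces applies.\<close>

lemma differential_along_smooth_path:
  assumes A: "smooth_atlas A" and H: "differentiable_fun_on A B H" and \<beta>: "smooth_path A \<beta>"
    and t: "t \<in> {0..1}" and tB: "\<beta> t \<in> B" and tan: "snd (velocity A \<beta> t) \<in> tangent_space A (\<beta> t)"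
  shows "((\<lambda>s. H (\<beta> s)) has_real_derivative differential A H (\<beta> t) (snd (velocity A \<beta> t)))
    (at t within {0..1})"
proof -
  have "\<beta> t \<in> (\<Union>c\<in>A. fst c)" using A by (simp add: smooth_atlas_def)
  then obtain c where c: "c \<in> A" "\<beta> t \<in> fst c" by blast
  let ?H = "\<lambda>x. H (chart_inv c x)" and ?x = "\<lambda>s. snd c (\<beta> s)"
  let ?D = "frechet_derivative ?H (at (?x t))"
  have "?H differentiable at (?x t)"
    using H tB c by (simp add: differentiable_fun_on_def)
  then have H': "(?H has_derivative ?D) (at (?x t))" and lin: "linear ?D"
    by (simp_all add: frechet_derivative_works linear_frechet_derivative)
  have "((\<lambda>s. ?H (?x s)) has_derivative (\<lambda>h. ?D (h *\<^sub>R coord_velocity c \<beta> t)))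
      (at t within {0..1})"
    using smooth_path_coord_velocity(1)[OF A \<beta> c t] H'
    unfolding has_vector_derivative_def by (rule has_derivative_compose)
  moreover have "?D (h *\<^sub>R coord_velocity c \<beta> t) = ?D (coord_velocity c \<beta> t) * h" for h
    using lin by (simp add: linear_scale)
  ultimately have "((\<lambda>s. ?H (?x s)) has_real_derivative ?D (coord_velocity c \<beta> t))
      (at t within {0..1})"
    unfolding has_field_derivative_def by (simp add: fun_eq_iff)
  moreover have inv: "?H (?x s) = H (\<beta> s)" if "\<beta> s \<in> fst c" for s
    using A c(1) that by (auto simp: smooth_atlas_def homeomorphism_def)
  \<comment> \<open>The path may leave the chart, so the two functions agree only near
    \<open>t\<close>. The filter omits \<open>t\<close> itself; there \<open>inv\<close> gives the
    equality.\<close>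
  have "eventually (\<lambda>s. ?H (?x s) = H (\<beta> s)) (at t within {0..1})"
    using smooth_path_coord_velocity(2)[OF A \<beta> c t] by eventually_elim (rule inv)
  ultimately have "((\<lambda>s. H (\<beta> s)) has_real_derivative ?D (coord_velocity c \<beta> t))
      (at t within {0..1})"
    unfolding has_field_derivative_def
    by (rule has_derivative_transform_eventually) (simp_all add: inv c t del: atLeastAtMost_iff)
  \<comment> \<open>\<open>differential\<close> evaluates in a chart picked by \<open>SOME\<close>;
    tangency of the velocity allows passing to \<open>c\<close>.\<close>
  then show ?thesis
    using differential_chart[OF A H tB c tan] c by (simp add: velocity_def)
qed

text \<open>Dividing the chord inequality by \<open>t > 0\<close> bounds each difference quotient at
  0 by \<open>a - f 0\<close>, and the bound survives the limit.\<close>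

lemma right_derivative_le_chord:
  fixes f :: "real \<Rightarrow> real"
  assumes D: "(f has_real_derivative D) (at 0 within {0..1})"
    and chord: "\<And>t. t \<in> {0..1} \<Longrightarrow> f t \<le> t * a + (1 - t) * f 0"
  shows "D \<le> a - f 0"
proof (rule tendsto_upperbound)
  show "((\<lambda>t. (f t - f 0) / (t - 0)) \<longlongrightarrow> D) (at 0 within {0..1})"
    using D by (simp add: has_field_derivative_iff)
  show "eventually (\<lambda>t. (f t - f 0) / (t - 0) \<le> a - f 0) (at 0 within {0..1})"
    unfolding eventually_at_topological
  proof (intro exI[of _ UNIV] conjI ballI impI)
    fix t :: real
    assume "t \<noteq> 0" "t \<in> {0..1}"
    then show "(f t - f 0) / (t - 0) \<le> a - f 0"
      using chord[of t] by (simp add: field_simps)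
  qed auto
  \<comment> \<open>Limits preserve bounds only along a nontrivial filter; this one is the
    right-sided filter at 0.\<close>
  show "at (0::real) within {0..1} \<noteq> bot"
    by (simp add: at_within_Icc_at_right)
qed

theorem theorem4p5:
  fixes A :: "('m::{t2_space, second_countable_topology}, 'e::real_normed_vector) chart set"
    and g :: "'m \<Rightarrow> ('m, 'e) tangent_vector \<Rightarrow> ('m, 'e) tangent_vector \<Rightarrow> real"
    and B :: "'m set"
    and E F :: "'m \<Rightarrow> 'm"
    and G :: "'m \<times> 'm \<Rightarrow> 'm \<times> ('m, 'e) tangent_vector"
    and H :: "'m \<Rightarrow> real"
  assumes "riemannian_manifold A g"
    and "B \<noteq> {}" and "open B"
    and "\<And>p q. G (p, q) \<in> tangent_bundle A"
    and "\<And>r s. r \<in> B \<Longrightarrow> s \<in> B \<Longrightarrow> G (E r, F s) \<in> {F s} \<times> tangent_space A (F s)"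
    and "geodesic_EF_invex_set A g G E F B"
    and "differentiable_fun_on A B H"
    and "EF_preinvex A g G E F B H"
  shows "EF_invex A g G E F B H"
  unfolding EF_invex_def
proof (intro conjI ballI impI)
  have atlas: "smooth_atlas A" using assms(1) by (simp add: riemannian_manifold_def)
  fix r s
  assume rs: "r \<in> B" "s \<in> B" "E r \<in> B" "F s \<in> B"
  define \<beta> where "\<beta> = invex_geodesic A g G B (E r) (F s)"
  have "\<exists>!\<beta>. is_invex_geodesic A g G B (E r) (F s) \<beta>"
    using assms(6) rs by (simp add: geodesic_EF_invex_set_def)
  then have "is_invex_geodesic A g G B (E r) (F s) \<beta>"
    unfolding \<beta>_def invex_geodesic_def by (rule theI')
  then have \<beta>: "smooth_path A \<beta>" "\<beta> 0 = F s" "velocity A \<beta> 0 = G (E r, F s)"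
    by (auto simp: is_invex_geodesic_def geodesic_def)
  \<comment> \<open>Tangency is inherited from \<open>G\<close>, whose value here is the initial
    velocity.\<close>
  have "snd (velocity A \<beta> 0) \<in> tangent_space A (\<beta> 0)"
    using assms(5)[OF rs(1,2)] \<beta> by auto
  then have "((\<lambda>t. H (\<beta> t)) has_real_derivative differential A H (\<beta> 0) (snd (velocity A \<beta> 0)))
      (at 0 within {0..1})"
    using \<beta> rs by (intro differential_along_smooth_path[OF atlas assms(7)]) auto
  moreover have "H (\<beta> t) \<le> t * H (E r) + (1 - t) * H (\<beta> 0)" if "t \<in> {0..1}" for t
    \<comment> \<open>\<open>\<beta> 0\<close> must become \<open>F s\<close> before
      \<open>\<beta>\<close> is expanded, since afterwards \<open>\<beta>(2)\<close> no longer
      matches.\<close>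
    using assms(8) rs that unfolding EF_preinvex_def \<beta>(2) unfolding \<beta>_def by blast
  ultimately have "differential A H (\<beta> 0) (snd (velocity A \<beta> 0)) \<le> H (E r) - H (\<beta> 0)"
    by (rule right_derivative_le_chord)
  then show "differential A H (F s) (snd (G (E r, F s))) \<le> H (E r) - H (F s)"
    by (simp add: \<beta>)
qed (use assms in auto)

end
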